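(* Let $(X,d)$ be a complete semimetric space with a continuous triangle function $\Phi$ satisfying the following conditions: 1) $\Phi(ku,kv)=k\Phi(u,v)$ for all $k,u,v\in[0,\infty)$; 2) for every $0\leqslant a<1$ there exists $C(a)>0$ such that for every positive integer $p$ one has $\Phi(1,\Phi(a,\Phi(a^2,\ldots,\Phi(a^{p-1},a^{p}))))\leqslant C(a)$; and suppose that the semimetric $d$ is continuous. Let $T\colon X\to X$ satisfy $$d(Tx,Ty)\leqslant\beta\,(d(x,Ty)+d(y,Tx))\quad\text{for all }x,y\in X$$ with some real number $\beta\geqslant0$ such that the following conditions hold: (i) $\Phi(0,\beta)<1$; (ii) if $\beta>0$, then $\Psi^{-1}(1/\beta)>1$, where $\Psi(u)=\Phi(u,1)$. Then $T$ has a fixed point. If $0\leqslant\beta<\frac12$, then the fixed point is unique.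
   Context: Let $X$ be a nonempty set. A semimetric on $X$ is a map $d\colon X\times X\to[0,\infty)$ such that $d(x,y)=0$ if and only if $x=y$, and $d(x,y)=d(y,x)$ for all $x,y\in X$ (no triangle inequality is required). The pair $(X,d)$ is then called a semimetric space. A function $\Phi\colon[0,\infty)\times[0,\infty)\to[0,\infty)$ is a triangle function for $d$ if $\Phi$ is symmetric, nondecreasing in each of its arguments, $\Phi(0,0)=0$, and $d(x,y)\leqslant\Phi(d(x,z),d(z,y))$ for all $x,y,z\in X$. Convergence, Cauchy sequences and completeness are defined as usual: $x_n\to x$ means $d(x_n,x)\to0$; $(x_n)$ is Cauchy if for every $\varepsilon>0$ there is $N$ with $d(x_n,x_m)<\varepsilon$ for all $n,m\geqslant N$; $(X,d)$ is complete if every Cauchy sequence converges to a point of $X$. The semimetric $d$ is continuous if $x_n\to x$ and $y_n\to y$ imply $d(x_n,y_n)\to d(x,y)$. For $p=1$ the nested expression in condition 2) is $\Phi(1,a)$, for $p=2$ it is $\Phi(1,\Phi(a,a^2))$, and so on (with $a^0=1$). For a nondecreasing function $\Psi$, the (generalized) inverse is defined by $\Psi^{-1}(\tau)=\inf\{t:\Psi(t)\geqslant\tau\}$, with values in $[0,\infty]$, where the infimum of the empty set is $\infty$. Here $\Psi$ is defined on $[0,\infty)$. *)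

theory Defs
  imports Complex_Main "HOL-Library.FuncSet" "HOL-Library.Extended_Nonnegative_Real"
begin

text \<open>
  A semimetric space is given by a carrier set \<open>X\<close> and a function \<open>d\<close> that is only
  constrained on \<open>X\<close>. Functions on \<open>[0, \<infinity>)\<close> are likewise real functions that are only
  constrained on \<open>{0..}\<close>.
\<close>

definition semimetric_space :: "'a set \<Rightarrow> ('a \<Rightarrow> 'a \<Rightarrow> real) \<Rightarrow> bool" where
  "semimetric_space X d \<longleftrightarrow>
     X \<noteq> {} \<and>
     (\<forall>x\<in>X. \<forall>y\<in>X. d x y \<ge> 0) \<and>
     (\<forall>x\<in>X. \<forall>y\<in>X. d x y = 0 \<longleftrightarrow> x = y) \<and>
     (\<forall>x\<in>X. \<forall>y\<in>X. d x y = d y x)"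

definition triangle_function :: "'a set \<Rightarrow> ('a \<Rightarrow> 'a \<Rightarrow> real) \<Rightarrow> (real \<Rightarrow> real \<Rightarrow> real) \<Rightarrow> bool" where
  "triangle_function X d \<Phi> \<longleftrightarrow>
     (\<forall>u\<ge>0. \<forall>v\<ge>0. \<Phi> u v \<ge> 0) \<and>
     (\<forall>u\<ge>0. \<forall>v\<ge>0. \<Phi> u v = \<Phi> v u) \<and>
     (\<forall>v\<ge>0. mono_on {0..} (\<lambda>u. \<Phi> u v)) \<and>
     (\<forall>u\<ge>0. mono_on {0..} (\<lambda>v. \<Phi> u v)) \<and>
     \<Phi> 0 0 = 0 \<and>
     (\<forall>x\<in>X. \<forall>y\<in>X. \<forall>z\<in>X. d x y \<le> \<Phi> (d x z) (d z y))"

definition semimetric_tendsto :: "('a \<Rightarrow> 'a \<Rightarrow> real) \<Rightarrow> (nat \<Rightarrow> 'a) \<Rightarrow> 'a \<Rightarrow> bool" where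
  "semimetric_tendsto d s x \<longleftrightarrow> (\<lambda>n. d (s n) x) \<longlonglongrightarrow> 0"

definition semimetric_Cauchy :: "('a \<Rightarrow> 'a \<Rightarrow> real) \<Rightarrow> (nat \<Rightarrow> 'a) \<Rightarrow> bool" where
  "semimetric_Cauchy d s \<longleftrightarrow> (\<forall>\<epsilon>>0. \<exists>N. \<forall>n\<ge>N. \<forall>m\<ge>N. d (s n) (s m) < \<epsilon>)"

definition semimetric_complete :: "'a set \<Rightarrow> ('a \<Rightarrow> 'a \<Rightarrow> real) \<Rightarrow> bool" where
  "semimetric_complete X d \<longleftrightarrow>
     (\<forall>s. range s \<subseteq> X \<and> semimetric_Cauchy d s \<longrightarrow> (\<exists>x\<in>X. semimetric_tendsto d s x))"

definition continuous_semimetric :: "'a set \<Rightarrow> ('a \<Rightarrow> 'a \<Rightarrow> real) \<Rightarrow> bool" where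
  "continuous_semimetric X d \<longleftrightarrow>
     (\<forall>s t x y. range s \<subseteq> X \<and> range t \<subseteq> X \<and> x \<in> X \<and> y \<in> X \<and>
        semimetric_tendsto d s x \<and> semimetric_tendsto d t y \<longrightarrow>
        (\<lambda>n. d (s n) (t n)) \<longlonglongrightarrow> d x y)"

text \<open>
  For \<open>p \<ge> 1\<close> this is \<open>\<Phi> 1 (\<Phi> a (\<Phi> (a ^ 2) (\<dots> (\<Phi> (a ^ (p - 1)) (a ^ p)))))\<close>, with \<open>a ^ 0 = 1\<close>
  also for \<open>a = 0\<close>.
\<close>
definition nested_powers :: "(real \<Rightarrow> real \<Rightarrow> real) \<Rightarrow> real \<Rightarrow> nat \<Rightarrow> real" where
  "nested_powers \<Phi> a p = foldr \<Phi> (map (\<lambda>i. a ^ i) [0..<p]) (a ^ p)"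

text \<open>
  The infimum is taken in \<open>[0, \<infinity>]\<close>, so it is \<open>\<infinity>\<close> if no \<open>t \<ge> 0\<close> satisfies \<open>\<Psi> t \<ge> \<tau>\<close>.
\<close>
definition generalized_inverse :: "(real \<Rightarrow> real) \<Rightarrow> real \<Rightarrow> ennreal" where
  "generalized_inverse \<Psi> \<tau> = (INF t\<in>{t. t \<ge> 0 \<and> \<Psi> t \<ge> \<tau>}. ennreal t)"

end

theory Submission
  imports Defs
begin

text \<open>
  Put \<open>x\<^sub>n = T\<^sup>n x\<^sub>0\<close> and \<open>d\<^sub>n = d(x\<^sub>n, x\<^sub>n\<^sub>+\<^sub>1)\<close>. As \<open>d(Tx\<^sub>n, x\<^sub>n\<^sub>+\<^sub>1) = 0\<close>, the contraction condition gives
  \<open>d\<^sub>n\<^sub>+\<^sub>1 \<le> \<beta> \<Phi>(d\<^sub>n, d\<^sub>n\<^sub>+\<^sub>1)\<close>; dividing by \<open>d\<^sub>n\<^sub>+\<^sub>1\<close>, homogeneity turns this into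
  \<open>\<Psi>(d\<^sub>n / d\<^sub>n\<^sub>+\<^sub>1) \<ge> 1 / \<beta>\<close>, so \<open>d\<^sub>n\<^sub>+\<^sub>1 \<le> d\<^sub>n / t\<close> for some \<open>t > 1\<close> independent of \<open>n\<close>. The bound on
  nested powers makes \<open>(x\<^sub>n)\<close> Cauchy. For its limit \<open>x\<close> the contraction condition and continuity
  of \<open>d\<close> give \<open>d(x, Tx) \<le> \<beta> d(x, Tx)\<close>. Finally \<open>\<beta> < 1\<close> as soon as \<open>X\<close> has two points, since
  \<open>d(x, y) \<le> \<Phi>(0, d(x, y)) = d(x, y) \<Phi>(0, 1)\<close> forces \<open>\<Phi>(0, 1) \<ge> 1\<close>.
\<close>

lemma semimetric_spaceD:
  assumes "semimetric_space X d" "x \<in> X" "y \<in> X"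
  shows "d x y \<ge> 0" "d x y = 0 \<longleftrightarrow> x = y" "d x y = d y x"
  using assms unfolding semimetric_space_def by auto

lemma triangle_function_nonneg:
  assumes "triangle_function X d \<Phi>" "u \<ge> 0" "v \<ge> 0"
  shows "\<Phi> u v \<ge> 0"
  using assms unfolding triangle_function_def by auto

lemma triangle_function_mono:
  assumes "triangle_function X d \<Phi>" "0 \<le> u" "u \<le> u'" "0 \<le> v" "v \<le> v'"
  shows "\<Phi> u v \<le> \<Phi> u' v'"
proof -
  have "\<Phi> u v \<le> \<Phi> u' v"
    using assms(1) mono_onD[of "{0..}" "\<lambda>u. \<Phi> u v" u u'] assms(2-)
    unfolding triangle_function_def by simp
  also have "\<dots> \<le> \<Phi> u' v'"
    using assms(1) mono_onD[of "{0..}" "\<lambda>v. \<Phi> u' v" v v'] assms(2-)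
    unfolding triangle_function_def by simp
  finally show ?thesis .
qed

lemma triangle_function_triangle:
  assumes "triangle_function X d \<Phi>" "x \<in> X" "y \<in> X" "z \<in> X"
  shows "d x y \<le> \<Phi> (d x z) (d z y)"
  using assms unfolding triangle_function_def by auto

lemma foldr_triangle_function_nonneg:
  assumes "triangle_function X d \<Phi>" "\<forall>u\<in>set us. u \<ge> 0" "v \<ge> 0"
  shows "foldr \<Phi> us v \<ge> 0"
  using assms(2) by (induction us) (auto intro: triangle_function_nonneg[OF assms(1)] assms(3))

text \<open>Induction on \<open>m\<close>, splitting off the first point: the triangle function is
  applied through \<open>s (Suc k)\<close>, the tail is bounded by the induction hypothesis, and
  homogeneity pulls out \<open>c\<close>. Since the tail starts at \<open>Suc k\<close>, the claim
  is stated for all \<open>k\<close>.\<close>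

lemma dist_le_foldr_powers:
  fixes s :: "nat \<Rightarrow> 'a"
  assumes semi: "semimetric_space X d"
    and tri: "triangle_function X d \<Phi>"
    and hom: "\<And>k u v. k \<ge> 0 \<Longrightarrow> u \<ge> 0 \<Longrightarrow> v \<ge> 0 \<Longrightarrow> \<Phi> (k * u) (k * v) = k * \<Phi> u v"
    and sX: "\<And>i. s i \<in> X"
    and "a \<ge> 0" "c \<ge> 0"
    and step: "\<And>i. d (s i) (s (Suc i)) \<le> c * a ^ i"
  shows "d (s k) (s (Suc (k + m))) \<le> c * foldr \<Phi> (map (\<lambda>i. a ^ i) [k..<k + m]) (a ^ (k + m))"
proof (induction m arbitrary: k)
  case 0
  then show ?case using step by simp
next
  case (Suc m)
  let ?F = "foldr \<Phi> (map (\<lambda>i. a ^ i) [Suc k..<Suc k + m]) (a ^ (Suc k + m))"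
  \<comment> \<open>Homogeneity is assumed for nonnegative arguments only.\<close>
  have F: "?F \<ge> 0"
    using \<open>a \<ge> 0\<close> by (intro foldr_triangle_function_nonneg[OF tri]) auto
  have "d (s k) (s (Suc (k + Suc m))) \<le> \<Phi> (d (s k) (s (Suc k))) (d (s (Suc k)) (s (Suc (Suc k + m))))"
    using triangle_function_triangle[OF tri sX sX sX] by simp
  also have "\<dots> \<le> \<Phi> (c * a ^ k) (c * ?F)"
    using Suc.IH step by (intro triangle_function_mono[OF tri] semimetric_spaceD(1)[OF semi] sX)
  also have "\<dots> = c * \<Phi> (a ^ k) ?F"
    using F \<open>a \<ge> 0\<close> \<open>c \<ge> 0\<close> by (intro hom) auto
  also have "\<Phi> (a ^ k) ?F = foldr \<Phi> (map (\<lambda>i. a ^ i) [k..<k + Suc m]) (a ^ (k + Suc m))"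
    using upt_conv_Cons[of k "k + Suc m"] by simp
  finally show ?case .
qed

text \<open>The tail from index \<open>n\<close> is again geometric, with first step at most
  \<open>D * a ^ n\<close>. So one bound \<open>C\<close> on the nested powers serves all tails, and
  the factor \<open>a ^ n\<close> makes the distances small.\<close>

lemma semimetric_Cauchy_if_geometric:
  fixes s :: "nat \<Rightarrow> 'a"
  assumes semi: "semimetric_space X d"
    and tri: "triangle_function X d \<Phi>"
    and hom: "\<And>k u v. k \<ge> 0 \<Longrightarrow> u \<ge> 0 \<Longrightarrow> v \<ge> 0 \<Longrightarrow> \<Phi> (k * u) (k * v) = k * \<Phi> u v"
    and sX: "\<And>i. s i \<in> X"
    and a: "0 \<le> a" "a < 1"
    and step: "\<And>i. d (s (Suc i)) (s (Suc (Suc i))) \<le> a * d (s i) (s (Suc i))"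
    and bound: "\<And>p. p \<ge> 1 \<Longrightarrow> nested_powers \<Phi> a p \<le> C"
  shows "semimetric_Cauchy d s"
proof -
  define D where "D = d (s 0) (s (Suc 0))"
  \<comment> \<open>The \<open>1\<close> covers adjacent points: there the nested expression has
    index 0 and equals 1, while \<open>C\<close> bounds it only from index 1 on.\<close>
  define B where "B = max 1 C * D"
  have "D \<ge> 0"
    unfolding D_def by (rule semimetric_spaceD(1)[OF semi sX sX])
  then have "B \<ge> 0"
    by (simp add: B_def)
  have geom: "d (s i) (s (Suc i)) \<le> D * a ^ i" for i
  proof (induction i)
    case (Suc i)
    have "a * d (s i) (s (Suc i)) \<le> a * (D * a ^ i)"
      using Suc.IH a(1) by (rule mult_left_mono)
    with step[of i] show ?case
      by (simp add: mult_ac)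
  qed (simp add: D_def)
  have le: "d (s n) (s (n + q)) \<le> B * a ^ n" for n q
  proof (cases q)
    case 0
    then show ?thesis
      using semimetric_spaceD(2)[OF semi sX sX, of n n] \<open>B \<ge> 0\<close> a by simp
  next
    case (Suc m)
    have Dn: "D * a ^ n \<ge> 0"
      using \<open>D \<ge> 0\<close> a by simp
    \<comment> \<open>The previous lemma is used for the shifted sequence with terms
      \<open>s (n + i)\<close>, at \<open>k = 0\<close> and with constant \<open>D * a ^ n\<close>,
      so that the exponents start at 0 as in \<open>nested_powers\<close>.\<close>
    have "d (s (n + 0)) (s (n + Suc (0 + m))) \<le> D * a ^ n * foldr \<Phi> (map (\<lambda>i. a ^ i) [0..<0 + m]) (a ^ (0 + m))"
      using geom[of "n + i" for i] sX a Dn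
      by (intro dist_le_foldr_powers[OF semi tri hom]) (auto simp: power_add mult_ac)
    then have "d (s n) (s (n + q)) \<le> D * a ^ n * nested_powers \<Phi> a m"
      using Suc by (simp add: nested_powers_def)
    also have "nested_powers \<Phi> a m \<le> max 1 C"
    proof (cases m)
      case 0
      then show ?thesis by (simp add: nested_powers_def)
    next
      case (Suc m')
      then show ?thesis using bound[of m] by simp
    qed
    then have "D * a ^ n * nested_powers \<Phi> a m \<le> D * a ^ n * max 1 C"
      using Dn by (rule mult_left_mono)
    finally show ?thesis
      by (simp add: B_def mult_ac)
  qed
  show ?thesis
    unfolding semimetric_Cauchy_def
  proof (intro allI impI)
    fix e :: real
    assume "e > 0"
    have "(\<lambda>n. B * a ^ n) \<longlonglongrightarrow> B * 0"
      using a by (intro tendsto_mult tendsto_const LIMSEQ_realpow_zero)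
    then have "eventually (\<lambda>n. B * a ^ n < e) sequentially"
      using \<open>e > 0\<close> by (simp add: order_tendsto_iff)
    then obtain N where N: "\<And>n. n \<ge> N \<Longrightarrow> B * a ^ n < e"
      by (auto simp: eventually_sequentially)
    have less: "d (s n) (s m) < e" if "n \<ge> N" "n \<le> m" for n m
      using le[of n "m - n"] N[OF that(1)] that(2) by simp
    show "\<exists>N. \<forall>n\<ge>N. \<forall>m\<ge>N. d (s n) (s m) < e"
      proof (intro exI allI impI)
      fix n m
      assume "n \<ge> N" "m \<ge> N"
      then show "d (s n) (s m) < e"
        using less[of n m] less[of m n] semimetric_spaceD(3)[OF semi sX sX, of n m]
        by (cases "n \<le> m") auto
    qed
  qed
qed

text \<open>The infimum may be infinite, so \<open>t\<close> is taken strictly between 1 and it: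
  this keeps \<open>t\<close> real and still a lower bound of the set.\<close>

lemma generalized_inverse_gt_oneE:
  assumes "generalized_inverse \<Psi> \<tau> > 1"
  obtains t where "t > 1" "\<And>u. u \<ge> 0 \<Longrightarrow> \<Psi> u \<ge> \<tau> \<Longrightarrow> t \<le> u"
proof -
  obtain r where r: "1 < r" "r < generalized_inverse \<Psi> \<tau>"
    using assms dense by blast
  then obtain t where t: "r = ennreal t" "t \<ge> 0"
    by (cases r) auto
  show thesis
  proof
    show "t > 1"
      using r(1) t by (simp add: ennreal_less_iff flip: ennreal_1)
  next
    fix u :: real
    assume u: "u \<ge> 0" "\<Psi> u \<ge> \<tau>"
    then have "generalized_inverse \<Psi> \<tau> \<le> ennreal u"
      unfolding generalized_inverse_def by (intro INF_lower) auto
    with r(2) have "ennreal t < ennreal u"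
      using t by (auto intro: less_le_trans)
    then show "t \<le> u"
      using u by (simp add: ennreal_less_iff t(2))
  qed
qed

theorem theorem4p2:
  fixes X :: "'a set" and d :: "'a \<Rightarrow> 'a \<Rightarrow> real" and \<Phi> :: "real \<Rightarrow> real \<Rightarrow> real"
    and T :: "'a \<Rightarrow> 'a" and \<beta> :: real
  assumes "semimetric_space X d"
    and "semimetric_complete X d"
    and "triangle_function X d \<Phi>"
    and "continuous_on ({0..} \<times> {0..}) (\<lambda>(u, v). \<Phi> u v)"
    and "\<And>k u v. k \<ge> 0 \<Longrightarrow> u \<ge> 0 \<Longrightarrow> v \<ge> 0 \<Longrightarrow> \<Phi> (k * u) (k * v) = k * \<Phi> u v"
    and "\<And>a. 0 \<le> a \<Longrightarrow> a < 1 \<Longrightarrow> \<exists>C>0. \<forall>p\<ge>1. nested_powers \<Phi> a p \<le> C"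
    and "continuous_semimetric X d"
    and "T \<in> X \<rightarrow> X"
    and "\<beta> \<ge> 0"
    and "\<And>x y. x \<in> X \<Longrightarrow> y \<in> X \<Longrightarrow> d (T x) (T y) \<le> \<beta> * (d x (T y) + d y (T x))"
    and "\<Phi> 0 \<beta> < 1"
    and "\<beta> > 0 \<Longrightarrow> generalized_inverse (\<lambda>u. \<Phi> u 1) (1 / \<beta>) > 1"
  shows "(\<exists>x\<in>X. T x = x) \<and> (\<beta> < 1 / 2 \<longrightarrow> (\<exists>!x. x \<in> X \<and> T x = x))"
proof -
  note semi = assms(1) and tri = assms(3) and hom = assms(5) and contr = assms(10)
  note dist_nonneg = semimetric_spaceD(1)[OF semi]
    and dist_zero = semimetric_spaceD(2)[OF semi]
    and dist_sym = semimetric_spaceD(3)[OF semi]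
  have TX: "T x \<in> X" if "x \<in> X" for x
    using assms(8) that by auto
  obtain x0 where x0: "x0 \<in> X"
    using semi unfolding semimetric_space_def by auto

  have ex: "\<exists>x\<in>X. T x = x"
  proof (cases "\<beta> = 0")
    case True
    \<comment> \<open>For \<beta> = 0 the map \<open>T\<close> is constant on \<open>X\<close>, so
      its value is a fixed point.\<close>
    have "d (T (T x0)) (T x0) = 0"
      using contr[of "T x0" x0] dist_nonneg[of "T (T x0)" "T x0"] x0 TX True by simp
    then show ?thesis
      using dist_zero x0 TX by blast
  next
    case False
    then have beta: "\<beta> > 0"
      using assms(9) by simp
    obtain t where t: "t > 1" "\<And>u. u \<ge> 0 \<Longrightarrow> \<Phi> u 1 \<ge> 1 / \<beta> \<Longrightarrow> t \<le> u"
      using generalized_inverse_gt_oneE[OF assms(12)[OF beta]] by blast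
    define s where "s n = (T ^^ n) x0" for n
    have s_Suc: "s (Suc n) = T (s n)" for n
      by (simp add: s_def)
    have sX: "s n \<in> X" for n
      by (induction n) (auto simp: s_def x0 TX)
    have step: "d (s (Suc n)) (s (Suc (Suc n))) \<le> (1 / t) * d (s n) (s (Suc n))" for n
    proof -
      define p where "p = d (s n) (s (Suc n))"
      define q where "q = d (s (Suc n)) (s (Suc (Suc n)))"
      have nonneg: "p \<ge> 0" "q \<ge> 0"
        unfolding p_def q_def by (intro dist_nonneg sX)+
      have "q \<le> \<beta> * d (s n) (s (Suc (Suc n)))"
        using contr[OF sX sX, of n "Suc n"] dist_zero[OF sX sX, of "Suc n" "Suc n"]
        by (simp add: q_def s_Suc)
      also have "\<dots> \<le> \<beta> * \<Phi> p q"
        unfolding p_def q_def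
        using beta by (intro mult_left_mono triangle_function_triangle[OF tri] sX) auto
      finally have q: "q \<le> \<beta> * \<Phi> p q" .
      have "q \<le> (1 / t) * p"
      proof (cases "q = 0")
        case True
        then show ?thesis using nonneg t(1) by simp
      next
        case False
        then have "q > 0" using nonneg by simp
        have "\<Phi> p q = q * \<Phi> (p / q) 1"
          using hom[of q "p / q" 1] \<open>q > 0\<close> nonneg by simp
        with q have "q * 1 \<le> q * (\<beta> * \<Phi> (p / q) 1)"
          by (simp add: mult_ac)
        then have "1 \<le> \<beta> * \<Phi> (p / q) 1"
          using \<open>q > 0\<close> by (simp only: mult_le_cancel_left_pos)
        then have "\<Phi> (p / q) 1 \<ge> 1 / \<beta>"
          using beta by (simp add: field_simps)
        then have "t \<le> p / q"
          using t(2) nonneg by simp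
        then show ?thesis
          using \<open>q > 0\<close> t(1) by (simp add: field_simps)
      qed
      then show ?thesis by (simp add: p_def q_def)
    qed
    have a: "0 \<le> 1 / t" "1 / t < 1"
      using t(1) by auto
    obtain C where C: "\<And>p. p \<ge> 1 \<Longrightarrow> nested_powers \<Phi> (1 / t) p \<le> C"
      using assms(6)[OF a] by blast
    have "semimetric_Cauchy d s"
      using semi tri hom sX a step C by (rule semimetric_Cauchy_if_geometric)
    then obtain x where x: "x \<in> X" and lim: "semimetric_tendsto d s x"
      using assms(2) sX unfolding semimetric_complete_def by (metis image_subsetI)
    have lim0: "(\<lambda>n. d (s n) x) \<longlonglongrightarrow> 0"
      using lim by (simp add: semimetric_tendsto_def)
    have lim': "(\<lambda>n. d (s n) (T x)) \<longlonglongrightarrow> d x (T x)"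
    proof -
      have "semimetric_tendsto d (\<lambda>_. T x) (T x)"
        using dist_zero[of "T x" "T x"] x TX by (simp add: semimetric_tendsto_def)
      with lim show ?thesis
        using sX x TX
        by (intro assms(7)[unfolded continuous_semimetric_def, rule_format, of s "\<lambda>_. T x"]) auto
    qed
    \<comment> \<open>Limit of the contraction condition for the pair \<open>s n\<close>,
      \<open>x\<close>; the summand 0 is the limit of \<open>d (s (Suc n)) x\<close>.\<close>
    have "d x (T x) \<le> \<beta> * (d x (T x) + 0)"
    proof (rule LIMSEQ_le)
      show "(\<lambda>n. d (s (Suc n)) (T x)) \<longlonglongrightarrow> d x (T x)"
        using lim' by (rule LIMSEQ_Suc)
      show "(\<lambda>n. \<beta> * (d (s n) (T x) + d (s (Suc n)) x)) \<longlonglongrightarrow> \<beta> * (d x (T x) + 0)"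
        by (intro tendsto_intros lim' LIMSEQ_Suc[OF lim0])
      show "\<exists>N. \<forall>n\<ge>N. d (s (Suc n)) (T x) \<le> \<beta> * (d (s n) (T x) + d (s (Suc n)) x)"
        using contr[OF sX x] dist_sym[OF x sX] by (simp flip: s_Suc)
    qed
    then have le: "d x (T x) \<le> \<beta> * d x (T x)"
      by simp
    have "d x (T x) = 0"
    proof (rule ccontr)
      assume "d x (T x) \<noteq> 0"
      then have pos: "d x (T x) > 0"
        using dist_nonneg[of x "T x"] x TX by simp
      \<comment> \<open>The intermediate point is \<open>x\<close> itself. This yields
        \<open>\<Phi> 0 1 \<ge> 1\<close>, and scaling by \<beta> gives
        \<open>\<beta> \<le> \<Phi> 0 \<beta> < 1\<close>, which contradicts
        \<open>le\<close>.\<close>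
      have "d x (T x) \<le> \<Phi> (d x x) (d x (T x))"
        using x TX by (intro triangle_function_triangle[OF tri])
      also have "\<dots> = d x (T x) * \<Phi> 0 1"
        using hom[of "d x (T x)" 0 1] pos dist_zero[of x x] x by simp
      finally have "\<Phi> 0 1 \<ge> 1"
        using pos by simp
      then have "\<beta> * 1 \<le> \<beta> * \<Phi> 0 1"
        using beta by (intro mult_left_mono) auto
      also have "\<dots> = \<Phi> 0 \<beta>"
        using hom[of \<beta> 0 1] beta by simp
      finally have "\<beta> < 1"
        using assms(11) by simp
      with le pos show False by simp
    qed
    then show ?thesis
      using dist_zero[of x "T x"] x TX by metis
  qed

  have uniq: "x = y" if "\<beta> < 1 / 2" "x \<in> X" "T x = x" "y \<in> X" "T y = y" for x y
  proof -
    \<comment> \<open>At two fixed points both distances on the right of the contraction condition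
      equal \<open>d x y\<close>.\<close>
    have "d x y \<le> 2 * \<beta> * d x y"
      using contr[of x y] dist_sym[of x y] that by simp
    moreover have "2 * \<beta> * d x y < d x y" if "d x y > 0"
      using that \<open>\<beta> < 1 / 2\<close> by simp
    ultimately have "d x y = 0"
      using dist_nonneg[of x y] that by linarith
    then show ?thesis
      using dist_zero that by blast
  qed
  show ?thesis
    using ex uniq by blast
qed

end
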